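(* Let $\mathcal E$ and $\overline{\mathcal E}$ be two ODEs of the form $y'=(p(x)y+q(x))^5+s(x)y+t(x)$ with $p\neq0$, for which $M_2\neq0$. Then $\mathcal E$ and $\overline{\mathcal E}$ are $G$-equivalent in the neighborhood of a point $x$ if and only if $$J^{\mathcal E}=J^{\overline{\mathcal E}},\qquad (\nabla J)^{\mathcal E}=(\nabla J)^{\overline{\mathcal E}}$$ and at least one of the functions $J^{\mathcal E}$, $(\nabla J)^{\mathcal E}$ has non-zero derivative at $x$.
   Context: All coefficients are $C^\infty$. $G$ is the pseudogroup of local (invertible) point transformations $x\mapsto f(x)$, $y\mapsto g(x)\cdot y+h(x)$, with $f,g,h$ smooth ($f'\ne 0$, $g\neq0$). Two equations are $G$-equivalent in the neighborhood of $x$ if some transformation in $G$, defined over a neighborhood of $x$, transforms one into the other. Put $$M_2=-p'q+q'p-pqs+tp^2,$$ $$M_4=p(pq''-qp'')+7p'(p'q-pq')+p^3t'-p^2qs'-6p^2sq'+p'p(11qs-5pt)+5p^2s(qs-pt),$$ $$J=\frac{M_4}{p^{2/5}\cdot M_2^{9/5}},\qquad \nabla=\frac{p^{3/5}}{M_2^{4/5}}\frac{D}{Dx},$$ where $\frac{D}{Dx}$ is the total derivative with respect to $x$ and fractional powers are taken with real fifth roots. A superscript $\mathcal E$ means evaluation at the coefficients $p,q,s,t$ of $\mathcal E$, giving functions of $x$.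
   Formalization: The non-zero-derivative condition is a hypothesis on E at x, not part of the criterion (y'=y^5+1 is equivalent to itself though J=∇J=0), and the equalities of J and ∇J are taken up to a local change of variable x→f(x), since translating x changes them as functions. *)

theory Defs
  imports "HOL-Analysis.Analysis"
begin

text \<open>\<open>C\<^sup>\<infinity>\<close> on a set, meant for open sets only: the iterated derivatives are two-sided.\<close>

definition smooth_on :: "real set \<Rightarrow> (real \<Rightarrow> real) \<Rightarrow> bool" where
  "smooth_on U f \<longleftrightarrow> (\<forall>k. \<forall>x\<in>U. (deriv ^^ k) f differentiable (at x))"


text \<open>The equation \<open>y' = (p(x) y + q(x))\<^sup>5 + s(x) y + t(x)\<close> for \<open>x\<close> in \<open>base\<close>;
  the values of the coefficients off \<open>base\<close> are irrelevant.\<close>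

record quintic_ode =
  base :: "real set"
  coef_p :: "real \<Rightarrow> real"
  coef_q :: "real \<Rightarrow> real"
  coef_s :: "real \<Rightarrow> real"
  coef_t :: "real \<Rightarrow> real"

definition ode_rhs :: "quintic_ode \<Rightarrow> real \<Rightarrow> real \<Rightarrow> real" where
  "ode_rhs E x y = (coef_p E x * y + coef_q E x) ^ 5 + coef_s E x * y + coef_t E x"

definition admissible :: "quintic_ode \<Rightarrow> bool" where
  "admissible E \<longleftrightarrow> open (base E) \<and>
     smooth_on (base E) (coef_p E) \<and> smooth_on (base E) (coef_q E) \<and>
     smooth_on (base E) (coef_s E) \<and> smooth_on (base E) (coef_t E) \<and>
     (\<forall>x\<in>base E. coef_p E x \<noteq> 0)"


text \<open>The part over \<open>V\<close> of the hypersurface in the space of 1-jets \<open>(x, y, y')\<close>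
  defined by the equation.\<close>

definition jet_locus :: "quintic_ode \<Rightarrow> real set \<Rightarrow> (real \<times> real \<times> real) set" where
  "jet_locus E V = {(x, y, z). x \<in> V \<and> z = ode_rhs E x y}"

definition local_change_on :: "real set \<Rightarrow> (real \<Rightarrow> real) \<Rightarrow> bool" where
  "local_change_on V f \<longleftrightarrow>
     open V \<and> smooth_on V f \<and> inj_on f V \<and> (\<forall>x\<in>V. deriv f x \<noteq> 0)"

text \<open>\<open>pseudogroup_on V f g h\<close>: the map \<open>(x, y) \<mapsto> (f x, g x * y + h x)\<close> is an element of the
  pseudogroup \<open>G\<close> defined over \<open>V\<close>.\<close>

definition pseudogroup_on ::
    "real set \<Rightarrow> (real \<Rightarrow> real) \<Rightarrow> (real \<Rightarrow> real) \<Rightarrow> (real \<Rightarrow> real) \<Rightarrow> bool" where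
  "pseudogroup_on V f g h \<longleftrightarrow>
     local_change_on V f \<and> smooth_on V g \<and> smooth_on V h \<and> (\<forall>x\<in>V. g x \<noteq> 0)"

text \<open>First prolongation of that map: the new slope is the total derivative of \<open>g x * y + h x\<close>
  divided by \<open>f' x\<close>.\<close>

definition prolong ::
    "(real \<Rightarrow> real) \<Rightarrow> (real \<Rightarrow> real) \<Rightarrow> (real \<Rightarrow> real) \<Rightarrow>
     real \<times> real \<times> real \<Rightarrow> real \<times> real \<times> real" where
  "prolong f g h = (\<lambda>(x, y, z).
     (f x, g x * y + h x, (deriv g x * y + deriv h x + g x * z) / deriv f x))"

text \<open>The point \<open>x\<close> need not be fixed by the transformation.\<close>

definition G_equivalent_near :: "quintic_ode \<Rightarrow> quintic_ode \<Rightarrow> real \<Rightarrow> bool" where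
  "G_equivalent_near E E' x \<longleftrightarrow>
     (\<exists>V f g h. x \<in> V \<and> V \<subseteq> base E \<and> pseudogroup_on V f g h \<and> f ` V \<subseteq> base E' \<and>
        prolong f g h ` jet_locus E V = jet_locus E' (f ` V))"


text \<open>A differential function is represented by its evaluation: it sends an equation to
  a function of \<open>x\<close>. The total derivative is then characterised by
  \<open>(D F / D x)\<^sup>E = d(F\<^sup>E) / d x\<close>.\<close>

type_synonym diff_fun = "quintic_ode \<Rightarrow> real \<Rightarrow> real"

definition total_deriv :: "diff_fun \<Rightarrow> diff_fun" where
  "total_deriv F = (\<lambda>E. deriv (F E))"

definition M2 :: diff_fun where
  "M2 E x =
    (let p = coef_p E x; q = coef_q E x; s = coef_s E x; t = coef_t E x;
         p1 = deriv (coef_p E) x; q1 = deriv (coef_q E) x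
     in - p1 * q + q1 * p - p * q * s + t * p^2)"

definition M4 :: diff_fun where
  "M4 E x =
    (let p = coef_p E x; q = coef_q E x; s = coef_s E x; t = coef_t E x;
         p1 = deriv (coef_p E) x; q1 = deriv (coef_q E) x;
         s1 = deriv (coef_s E) x; t1 = deriv (coef_t E) x;
         p2 = deriv (deriv (coef_p E)) x; q2 = deriv (deriv (coef_q E)) x
     in p * (p * q2 - q * p2) + 7 * p1 * (p1 * q - p * q1) + p^3 * t1 - p^2 * q * s1
        - 6 * p^2 * s * q1 + p1 * p * (11 * q * s - 5 * p * t)
        + 5 * p^2 * s * (q * s - p * t))"

text \<open>Fractional powers are \<open>z\<^bsup>k/5\<^esup> = (root 5 z) ^ k\<close> with the real fifth root, also for
  negative \<open>z\<close>; \<open>powr\<close> would be wrong there.\<close>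

definition J :: diff_fun where
  "J E x = M4 E x / (root 5 (coef_p E x) ^ 2 * root 5 (M2 E x) ^ 9)"

definition nabla :: "diff_fun \<Rightarrow> diff_fun" where
  "nabla F = (\<lambda>E x.
     root 5 (coef_p E x) ^ 3 / root 5 (M2 E x) ^ 4 * total_deriv F E x)"

end

theory Submission
  imports Defs "HOL-Computational_Algebra.Polynomial"
begin

text \<open>Write \<open>u = p y + q\<close>. In this variable the equation \<open>y' = (p y + q)\<^sup>5 + s y + t\<close> becomes
\<open>u' = p u\<^sup>5 + A u + B\<close> with \<open>A = p'/p + s\<close> and \<open>B = M\<^sub>2/p\<close>: the terms of degree 2, 3 and 4 are
gone (\<open>reduced_rhs\<close>). Putting \<open>u = \<lambda> v\<close> with \<open>\<lambda>\<^sup>5 = M\<^sub>2/p\<^sup>2\<close> makes the coefficients of degree 5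
and 0 equal, and the equation becomes
\<open>v' = \<mu> (v\<^sup>5 - (J/5) v + 1)\<close>, where \<open>\<mu> = p \<lambda>\<^sup>4\<close>.
Indeed \<open>M\<^sub>4 = p M\<^sub>2' - 7 p' M\<^sub>2 - 5 s p M\<^sub>2\<close> (\<open>M4_eq\<close>), which identifies \<open>J\<close> with the remaining
coefficient (\<open>J_eq\<close>), and \<open>\<nabla>\<close> is \<open>\<mu>\<^sup>-\<^sup>1 d/dx\<close> (\<open>nabla_eq\<close>). So an equation amounts to the function \<open>J\<close>
together with the one-form \<open>\<mu> dx\<close>.

A fibrewise affine map that sends one equation to another must match the reduced equations, hence
act on \<open>v\<close> as the identity: the missing term of degree 4 excludes a translation, and comparing the
coefficients of degree 5 and 0 excludes a dilation. What is left is a change \<open>f\<close> of the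
independent variable with \<open>f\<^sup>* (\<mu>\<^sub>E' dx) = \<mu>\<^sub>E dx\<close> and \<open>J\<^sub>E' \<circ> f = J\<^sub>E\<close>
(\<open>normal_form_match_iff\<close>), and conversely every such \<open>f\<close> lifts to an equivalence. Differentiating
the second condition and using the first gives the equality of the \<open>\<nabla> J\<close>.

For the converse, suppose that \<open>f\<close> matches \<open>J\<close> and \<open>\<nabla> J\<close>. Differentiating \<open>J\<^sub>E' \<circ> f = J\<^sub>E\<close> gives
\<open>\<nabla> J \<sqdot> (\<mu>\<^sub>E' \<circ> f) f' = \<nabla> J \<sqdot> \<mu>\<^sub>E\<close>, so the one-forms match wherever \<open>\<nabla> J \<noteq> 0\<close>. The regularity
assumption makes \<open>\<nabla> J\<close> nonzero at least in a punctured neighbourhood of \<open>x\<close>, and at \<open>x\<close> itself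
the forms match by continuity (\<open>invariants_imp_G_equivalent\<close>).\<close>

section \<open>Calculus of smooth functions\<close>

lemma smooth_on_has_deriv:
  assumes "smooth_on U f" "x \<in> U"
  shows "(f has_real_derivative deriv f x) (at x)"
proof -
  have "f differentiable (at x)"
    using assms unfolding smooth_on_def by (metis funpow_0)
  then show ?thesis
    by (simp add: DERIV_deriv_iff_real_differentiable)
qed

lemma smooth_on_deriv:
  assumes "smooth_on U f"
  shows "smooth_on U (deriv f)"
  using assms unfolding smooth_on_def by (metis funpow_Suc_right comp_apply)

lemma smooth_on_subset:
  assumes "smooth_on U f" "V \<subseteq> U"
  shows "smooth_on V f"
  using assms unfolding smooth_on_def by blast

text \<open>Since smoothness speaks of iterated derivatives, the direct route to closure properties would be
a Leibniz or Faa di Bruno formula. It is avoided here: any family of functions in which each member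
has its derivative on \<open>U\<close> in the family again consists of smooth functions, because by induction
each iterated derivative agrees on \<open>U\<close> with a member.\<close>

lemma smooth_on_coinduct:
  assumes "open U" "f \<in> F"
    and step: "\<And>f. f \<in> F \<Longrightarrow> \<exists>f'\<in>F. \<forall>x\<in>U. (f has_real_derivative f' x) (at x)"
  shows "smooth_on U f"
proof -
  have agree: "\<exists>\<phi>\<in>F. \<forall>x\<in>U. (deriv ^^ k) f x = \<phi> x" for k
  proof (induction k)
    case 0
    then show ?case using \<open>f \<in> F\<close> by auto
  next
    case (Suc k)
    then obtain \<phi> where \<phi>: "\<phi> \<in> F" "\<forall>x\<in>U. (deriv ^^ k) f x = \<phi> x" by blast
    obtain \<phi>' where \<phi>': "\<phi>' \<in> F" "\<forall>x\<in>U. (\<phi> has_real_derivative \<phi>' x) (at x)"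
      using step[OF \<phi>(1)] by blast
    have "(deriv ^^ Suc k) f x = \<phi>' x" if "x \<in> U" for x
    proof -
      have "((deriv ^^ k) f has_real_derivative \<phi>' x) (at x)"
        by (rule has_field_derivative_transform_within_open[OF _ \<open>open U\<close> that, of \<phi>])
          (use \<phi>(2) \<phi>'(2) that in auto)
      then show ?thesis by (simp add: DERIV_imp_deriv)
    qed
    then show ?case using \<phi>'(1) by blast
  qed
  show ?thesis unfolding smooth_on_def
  proof (intro allI ballI)
    fix k x assume "x \<in> U"
    obtain \<phi> where \<phi>: "\<phi> \<in> F" "\<forall>x\<in>U. (deriv ^^ k) f x = \<phi> x" using agree by blast
    obtain \<phi>' where \<phi>': "\<forall>x\<in>U. (\<phi> has_real_derivative \<phi>' x) (at x)"
      using step[OF \<phi>(1)] by blast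
    have "((deriv ^^ k) f has_real_derivative \<phi>' x) (at x)"
      by (rule has_field_derivative_transform_within_open[OF _ \<open>open U\<close> \<open>x \<in> U\<close>, of \<phi>])
        (use \<phi>(2) \<phi>' \<open>x \<in> U\<close> in auto)
    then show "(deriv ^^ k) f differentiable (at x)"
      using real_differentiable_def by blast
  qed
qed

lemma smooth_on_const: "open U \<Longrightarrow> smooth_on U (\<lambda>_. c)"
  by (rule smooth_on_coinduct[where F = "range (\<lambda>c _. c)"])
    (auto intro!: exI[of _ 0])

text \<open>The operations are closed up simultaneously because the derivative of one involves the others: the
derivative of a root, for instance, is a product with an inverse of a power of the root. The
exponent is odd, so that the root inverts the power also at negative values.\<close>

inductive_set smooth_closure :: "real set \<Rightarrow> (real \<Rightarrow> real) set" for U where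
  of_smooth: "smooth_on U f \<Longrightarrow> f \<in> smooth_closure U"
| add: "f \<in> smooth_closure U \<Longrightarrow> g \<in> smooth_closure U \<Longrightarrow> (\<lambda>x. f x + g x) \<in> smooth_closure U"
| mult: "f \<in> smooth_closure U \<Longrightarrow> g \<in> smooth_closure U \<Longrightarrow> (\<lambda>x. f x * g x) \<in> smooth_closure U"
| inverse: "f \<in> smooth_closure U \<Longrightarrow> \<forall>x\<in>U. f x \<noteq> 0 \<Longrightarrow> (\<lambda>x. inverse (f x)) \<in> smooth_closure U"
| root: "f \<in> smooth_closure U \<Longrightarrow> \<forall>x\<in>U. f x \<noteq> 0 \<Longrightarrow> odd n \<Longrightarrow>
    (\<lambda>x. root n (f x)) \<in> smooth_closure U"
| compose: "smooth_on W \<phi> \<Longrightarrow> f \<in> smooth_closure U \<Longrightarrow> f ` U \<subseteq> W \<Longrightarrow>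
    (\<lambda>x. \<phi> (f x)) \<in> smooth_closure U"

lemma smooth_closure_power:
  assumes "open U" "f \<in> smooth_closure U"
  shows "(\<lambda>x. f x ^ n) \<in> smooth_closure U"
proof (induction n)
  case 0
  then show ?case using smooth_on_const[OF assms(1)] by (simp add: smooth_closure.of_smooth)
next
  case (Suc n)
  then show ?case using smooth_closure.mult[OF assms(2)] by simp
qed

lemma smooth_closure_smooth:
  assumes "open U" "f \<in> smooth_closure U"
  shows "smooth_on U f"
proof (rule smooth_on_coinduct[OF assms])
  have const: "(\<lambda>_. c) \<in> smooth_closure U" for c
    by (simp add: smooth_closure.of_smooth smooth_on_const[OF \<open>open U\<close>])
  fix f assume "f \<in> smooth_closure U"
  then show "\<exists>f'\<in>smooth_closure U. \<forall>x\<in>U. (f has_real_derivative f' x) (at x)"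
  proof induction
    case (of_smooth f)
    then show ?case
      by (meson smooth_closure.of_smooth smooth_on_deriv smooth_on_has_deriv)
  next
    case (add f g)
    then obtain f' g' where "f' \<in> smooth_closure U" "g' \<in> smooth_closure U"
      "\<forall>x\<in>U. (f has_real_derivative f' x) (at x)" "\<forall>x\<in>U. (g has_real_derivative g' x) (at x)"
      by blast
    then show ?case
      by (intro bexI[of _ "\<lambda>x. f' x + g' x"]) (auto intro!: DERIV_add smooth_closure.add)
  next
    case (mult f g)
    then obtain f' g' where "f' \<in> smooth_closure U" "g' \<in> smooth_closure U"
      "\<forall>x\<in>U. (f has_real_derivative f' x) (at x)" "\<forall>x\<in>U. (g has_real_derivative g' x) (at x)"
      by blast
    then show ?case using mult.hyps
      by (intro bexI[of _ "\<lambda>x. f' x * g x + g' x * f x"])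
        (auto intro!: DERIV_mult smooth_closure.add smooth_closure.mult)
  next
    case (inverse f)
    then obtain f' where f': "f' \<in> smooth_closure U"
      "\<forall>x\<in>U. (f has_real_derivative f' x) (at x)"
      by blast
    have "(\<lambda>x. (-1) * (inverse (f x) * f' x * inverse (f x))) \<in> smooth_closure U"
      by (intro smooth_closure.mult smooth_closure.inverse const f' inverse.hyps)
    moreover have "\<forall>x\<in>U. ((\<lambda>x. inverse (f x)) has_real_derivative
        (-1) * (inverse (f x) * f' x * inverse (f x))) (at x)" (is "\<forall>x\<in>U. ?D x")
    proof
      fix x assume "x \<in> U"
      then show "?D x"
        using DERIV_inverse'[of f "f' x" x UNIV] f'(2) inverse.hyps by simp
    qed
    ultimately show ?case by - (rule bexI[rotated], assumption+)
  next
    case (root f n)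
    then obtain f' where f': "f' \<in> smooth_closure U"
      "\<forall>x\<in>U. (f has_real_derivative f' x) (at x)"
      by blast
    have "(\<lambda>x. inverse (real n * root n (f x) ^ (n - Suc 0)) * f' x) \<in> smooth_closure U"
      by (intro smooth_closure.mult smooth_closure.inverse smooth_closure_power[OF \<open>open U\<close>]
          smooth_closure.root const f' root.hyps)
        (use root.hyps odd_pos[of n] in auto)
    moreover have "\<forall>x\<in>U. ((\<lambda>x. root n (f x)) has_real_derivative
        inverse (real n * root n (f x) ^ (n - Suc 0)) * f' x) (at x)" (is "\<forall>x\<in>U. ?D x")
    proof
      fix x assume "x \<in> U"
      then show "?D x"
        using DERIV_chain2[where g = f, OF DERIV_odd_real_root[of n "f x"], of "f' x" UNIV] f'(2) root.hyps by simp
    qed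
    ultimately show ?case by - (rule bexI[rotated], assumption+)
  next
    case (compose W \<phi> f)
    then obtain f' where f': "f' \<in> smooth_closure U"
      "\<forall>x\<in>U. (f has_real_derivative f' x) (at x)"
      by blast
    have "(\<lambda>x. deriv \<phi> (f x) * f' x) \<in> smooth_closure U"
      by (rule smooth_closure.mult[OF smooth_closure.compose[OF smooth_on_deriv[OF compose.hyps(1)]
              compose.hyps(2,3)] f'(1)])
    moreover have "\<forall>x\<in>U. ((\<lambda>x. \<phi> (f x)) has_real_derivative deriv \<phi> (f x) * f' x) (at x)" (is "\<forall>x\<in>U. ?D x")
    proof
      fix x assume "x \<in> U"
      then show "?D x"
        using DERIV_chain2[where g = f, OF smooth_on_has_deriv[OF compose.hyps(1), of "f x"], of "f' x" UNIV]
        f'(2) compose.hyps(3) by blast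
    qed
    ultimately show ?case by - (rule bexI[rotated], assumption+)
  qed
qed

lemma
  assumes "open U" "smooth_on U f"
  shows smooth_on_inverse: "\<forall>x\<in>U. f x \<noteq> 0 \<Longrightarrow> smooth_on U (\<lambda>x. inverse (f x))"
    and smooth_on_root: "\<forall>x\<in>U. f x \<noteq> 0 \<Longrightarrow> odd n \<Longrightarrow> smooth_on U (\<lambda>x. root n (f x))"
    and smooth_on_power: "smooth_on U (\<lambda>x. f x ^ n)"
    and smooth_on_minus: "smooth_on U (\<lambda>x. - f x)"
    and smooth_on_compose: "smooth_on W \<phi> \<Longrightarrow> f ` U \<subseteq> W \<Longrightarrow> smooth_on U (\<lambda>x. \<phi> (f x))"
proof -
  note closure = smooth_closure_smooth[OF assms(1)] smooth_closure.of_smooth[OF assms(2)]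
  show "smooth_on U (\<lambda>x. inverse (f x))" if "\<forall>x\<in>U. f x \<noteq> 0"
    by (intro closure smooth_closure.inverse that)
  show "smooth_on U (\<lambda>x. root n (f x))" if "\<forall>x\<in>U. f x \<noteq> 0" "odd n"
    by (intro closure smooth_closure.root that)
  show "smooth_on U (\<lambda>x. f x ^ n)"
    by (intro closure smooth_closure_power assms(1))
  have "(\<lambda>x. (-1) * f x) \<in> smooth_closure U"
    by (intro closure smooth_closure.mult smooth_closure.of_smooth[OF smooth_on_const[OF assms(1)]])
  then show "smooth_on U (\<lambda>x. - f x)" using closure(1) by simp
  show "smooth_on U (\<lambda>x. \<phi> (f x))" if "smooth_on W \<phi>" "f ` U \<subseteq> W"
    by (rule closure(1), rule smooth_closure.compose[OF that(1) closure(2) that(2)])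
qed

lemma
  assumes "open U" "smooth_on U f" "smooth_on U g"
  shows smooth_on_add: "smooth_on U (\<lambda>x. f x + g x)"
    and smooth_on_mult: "smooth_on U (\<lambda>x. f x * g x)"
    and smooth_on_diff: "smooth_on U (\<lambda>x. f x - g x)"
    and smooth_on_divide: "\<forall>x\<in>U. g x \<noteq> 0 \<Longrightarrow> smooth_on U (\<lambda>x. f x / g x)"
proof -
  note in_closure = smooth_closure.of_smooth
  have add: "smooth_on U (\<lambda>x. f x + k x)" if "smooth_on U k" for k
    by (rule smooth_closure_smooth[OF assms(1)
          smooth_closure.add[OF in_closure[OF assms(2)] in_closure[OF that]]])
  have mult: "smooth_on U (\<lambda>x. f x * k x)" if "smooth_on U k" for k
    by (rule smooth_closure_smooth[OF assms(1)
          smooth_closure.mult[OF in_closure[OF assms(2)] in_closure[OF that]]])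
  show "smooth_on U (\<lambda>x. f x + g x)" by (rule add[OF assms(3)])
  show "smooth_on U (\<lambda>x. f x * g x)" by (rule mult[OF assms(3)])
  show "smooth_on U (\<lambda>x. f x - g x)"
    using add[OF smooth_on_minus[OF assms(1,3)]] by simp
  show "smooth_on U (\<lambda>x. f x / g x)" if "\<forall>x\<in>U. g x \<noteq> 0"
    using mult[OF smooth_on_inverse[OF assms(1,3) that]] by (simp add: divide_inverse)
qed

lemmas smooth_intros = smooth_on_const smooth_on_add smooth_on_mult smooth_on_diff smooth_on_minus
  smooth_on_divide smooth_on_power smooth_on_root smooth_on_deriv

section \<open>Normal form of an equation\<close>

text \<open>These are the functions \<open>A\<close>, \<open>\<lambda>\<close> and \<open>\<mu>\<close> of the introduction: the linear coefficient of the
reduced equation, the unit of the variable \<open>u\<close>, and the density of the invariant one-form.\<close>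

definition lin_coef :: diff_fun where
  "lin_coef E x = deriv (coef_p E) x / coef_p E x + coef_s E x"

definition scale_factor :: diff_fun where
  "scale_factor E x = root 5 (M2 E x / coef_p E x ^ 2)"

definition speed :: diff_fun where
  "speed E x = coef_p E x * scale_factor E x ^ 4"

locale nondegenerate =
  fixes E :: quintic_ode
  assumes admissible: "admissible E"
    and M2_nz: "z \<in> base E \<Longrightarrow> M2 E z \<noteq> 0"
begin

lemma open_base: "open (base E)"
  and smooth_p: "smooth_on (base E) (coef_p E)"
  and smooth_q: "smooth_on (base E) (coef_q E)"
  and smooth_s: "smooth_on (base E) (coef_s E)"
  and smooth_t: "smooth_on (base E) (coef_t E)"
  and p_nz: "z \<in> base E \<Longrightarrow> coef_p E z \<noteq> 0"
  using admissible by (auto simp: admissible_def)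

lemma scale_pow5: "z \<in> base E \<Longrightarrow> scale_factor E z ^ 5 * coef_p E z ^ 2 = M2 E z"
  using p_nz by (simp add: scale_factor_def odd_real_root_pow)

lemma scale_nz: "z \<in> base E \<Longrightarrow> scale_factor E z \<noteq> 0"
  using p_nz M2_nz by (simp add: scale_factor_def)

lemma speed_nz: "z \<in> base E \<Longrightarrow> speed E z \<noteq> 0"
  using p_nz scale_nz by (simp add: speed_def)

lemma constant_term_eq:
  "z \<in> base E \<Longrightarrow> M2 E z / coef_p E z = scale_factor E z ^ 5 * coef_p E z"
  using p_nz by (simp add: power2_eq_square flip: scale_pow5)

lemma smooth_M2: "smooth_on (base E) (M2 E)"
  unfolding M2_def Let_def
  by (intro smooth_intros open_base smooth_p smooth_q smooth_s smooth_t)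

lemma smooth_M4: "smooth_on (base E) (M4 E)"
  unfolding M4_def Let_def
  by (intro smooth_intros open_base smooth_p smooth_q smooth_s smooth_t)

lemma smooth_scale: "smooth_on (base E) (scale_factor E)"
  unfolding scale_factor_def
  by (intro smooth_intros open_base smooth_p smooth_M2) (use p_nz M2_nz in auto)

lemma smooth_speed: "smooth_on (base E) (speed E)"
  unfolding speed_def
  by (intro smooth_intros open_base smooth_p smooth_scale)

lemma smooth_J: "smooth_on (base E) (J E)"
  unfolding J_def
  by (intro smooth_intros open_base smooth_p smooth_M2 smooth_M4) (use p_nz M2_nz in auto)

lemma smooth_nabla_J: "smooth_on (base E) (nabla J E)"
  unfolding nabla_def total_deriv_def
  by (intro smooth_intros open_base smooth_p smooth_M2 smooth_J) (use p_nz M2_nz in auto)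

lemma reduced_rhs:
  assumes "z \<in> base E"
  defines "u y \<equiv> coef_p E z * y + coef_q E z"
  shows "deriv (coef_p E) z * y + deriv (coef_q E) z + coef_p E z * ode_rhs E z y =
    coef_p E z * u y ^ 5 + lin_coef E z * u y + M2 E z / coef_p E z"
  using p_nz[OF assms(1)]
  unfolding M2_def Let_def lin_coef_def ode_rhs_def u_def
  by (simp add: field_simps power2_eq_square)

text \<open>This explains where \<open>M\<^sub>4\<close> comes from: up to the factor \<open>p M\<^sub>2\<close> it is the logarithmic derivative of
\<open>M\<^sub>2/p\<^sup>7\<close> minus \<open>5 s\<close>.\<close>

lemma M4_eq:
  assumes "z \<in> base E"
  shows "M4 E z = coef_p E z * deriv (M2 E) z - 7 * deriv (coef_p E) z * M2 E z
    - 5 * coef_s E z * coef_p E z * M2 E z"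
proof -
  note d = smooth_on_has_deriv[OF _ assms]
  have dM2: "deriv (M2 E) z =
    - (deriv (deriv (coef_p E)) z * coef_q E z + deriv (coef_q E) z * deriv (coef_p E) z)
    + (deriv (deriv (coef_q E)) z * coef_p E z + deriv (coef_p E) z * deriv (coef_q E) z)
    - ((deriv (coef_p E) z * coef_q E z + deriv (coef_q E) z * coef_p E z) * coef_s E z
       + deriv (coef_s E) z * (coef_p E z * coef_q E z))
    + (deriv (coef_t E) z * coef_p E z ^ 2 + 2 * coef_p E z * deriv (coef_p E) z * coef_t E z)"
    unfolding M2_def Let_def
    by (rule DERIV_imp_deriv)
      (auto intro!: derivative_eq_intros d smooth_on_deriv smooth_p smooth_q smooth_s smooth_t
        simp: algebra_simps)
  show ?thesis
    unfolding dM2 M4_def M2_def[of E z] Let_def by algebra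
qed

lemma speed_eq:
  assumes "z \<in> base E"
  shows "speed E z = root 5 (M2 E z) ^ 4 / root 5 (coef_p E z) ^ 3"
proof -
  define \<rho> m where "\<rho> = root 5 (coef_p E z)" and "m = root 5 (M2 E z)"
  have "\<rho> \<noteq> 0" using assms p_nz by (simp add: \<rho>_def)
  have p: "coef_p E z = \<rho> ^ 5" by (simp add: \<rho>_def odd_real_root_pow)
  have scale: "scale_factor E z = m / \<rho> ^ 2"
    by (simp add: scale_factor_def real_root_divide real_root_power \<rho>_def m_def)
  have "speed E z = m ^ 4 / \<rho> ^ 3"
    unfolding speed_def p scale using \<open>\<rho> \<noteq> 0\<close>
    by (simp add: field_simps flip: power_add power_mult)
  then show ?thesis by (simp add: \<rho>_def m_def)
qed

lemma nabla_eq: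
  assumes "z \<in> base E"
  shows "nabla F E z = deriv (F E) z / speed E z"
  by (simp add: nabla_def total_deriv_def speed_eq[OF assms])

text \<open>After the rescaling \<open>u = \<lambda> v\<close> the linear coefficient is \<open>A - \<lambda>'/\<lambda>\<close>, so \<open>J\<close> is \<open>-5\<close> times this
coefficient measured in units of \<open>\<mu>\<close>. In terms of the fifth roots of \<open>p\<close> and \<open>M\<^sub>2\<close> everything is
rational, and \<open>\<lambda>'/\<lambda>\<close> comes from differentiating \<open>\<lambda>\<^sup>5 p\<^sup>2 = M\<^sub>2\<close>.\<close>

lemma J_eq:
  assumes "z \<in> base E"
  shows "J E z * speed E z = 5 * (deriv (scale_factor E) z / scale_factor E z - lin_coef E z)"
proof -
  define \<rho> m where "\<rho> = root 5 (coef_p E z)" and "m = root 5 (M2 E z)"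
  have nz: "\<rho> \<noteq> 0" "m \<noteq> 0" using assms p_nz M2_nz by (auto simp: \<rho>_def m_def)
  have p: "coef_p E z = \<rho> ^ 5" and M: "M2 E z = m ^ 5"
    by (simp_all add: \<rho>_def m_def odd_real_root_pow)
  have "J E z * speed E z = M4 E z / (\<rho> ^ 5 * m ^ 5)"
    unfolding J_def speed_eq[OF assms] \<rho>_def[symmetric] m_def[symmetric]
    using nz by (simp add: field_simps flip: power_add)
  also have "\<dots> = deriv (M2 E) z / M2 E z - 7 * deriv (coef_p E) z / coef_p E z - 5 * coef_s E z"
    using nz unfolding M4_eq[OF assms] p M by (simp add: field_simps)
  also have "\<dots> = 5 * (deriv (scale_factor E) z / scale_factor E z - lin_coef E z)"
  proof -
    note d = smooth_on_has_deriv[OF _ assms]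
    have "((\<lambda>z. scale_factor E z ^ 5 * coef_p E z ^ 2) has_real_derivative
        5 * scale_factor E z ^ 4 * deriv (scale_factor E) z * coef_p E z ^ 2
        + scale_factor E z ^ 5 * (2 * coef_p E z * deriv (coef_p E) z)) (at z)"
      by (auto intro!: derivative_eq_intros d smooth_p smooth_scale)
    then have "(M2 E has_real_derivative
        5 * scale_factor E z ^ 4 * deriv (scale_factor E) z * coef_p E z ^ 2
        + scale_factor E z ^ 5 * (2 * coef_p E z * deriv (coef_p E) z)) (at z)"
      by (rule has_field_derivative_transform_within_open[OF _ open_base assms])
        (simp add: scale_pow5)
    then have M': "deriv (M2 E) z = 5 * scale_factor E z ^ 4 * deriv (scale_factor E) z * coef_p E z ^ 2
        + scale_factor E z ^ 5 * (2 * coef_p E z * deriv (coef_p E) z)"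
      by (rule DERIV_imp_deriv)
    have "deriv (M2 E) z / M2 E z =
      5 * deriv (scale_factor E) z / scale_factor E z + 2 * deriv (coef_p E) z / coef_p E z"
      using scale_nz[OF assms] p_nz[OF assms] unfolding M' scale_pow5[OF assms, symmetric]
      by (simp add: field_simps eval_nat_numeral)
    then show ?thesis using p_nz[OF assms] by (simp add: lin_coef_def field_simps)
  qed
  finally show ?thesis .
qed

end

section \<open>Equivalence in terms of normal forms\<close>

text \<open>The pointwise condition gives one inclusion directly, and the other because \<open>g \<noteq> 0\<close> makes
the map surjective on each fibre.\<close>

lemma prolong_image_iff:
  assumes "\<forall>z\<in>V. g z \<noteq> 0"
  shows "prolong f g h ` jet_locus E V = jet_locus E' (f ` V) \<longleftrightarrow>
    (\<forall>z\<in>V. \<forall>y. (deriv g z * y + deriv h z + g z * ode_rhs E z y) / deriv f z =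
       ode_rhs E' (f z) (g z * y + h z))" (is "?L \<longleftrightarrow> ?R")
proof
  assume ?L
  show ?R
  proof (intro ballI allI)
    fix z y assume "z \<in> V"
    then have "prolong f g h (z, y, ode_rhs E z y) \<in> jet_locus E' (f ` V)"
      unfolding \<open>?L\<close>[symmetric] by (intro imageI) (simp add: jet_locus_def)
    then show "(deriv g z * y + deriv h z + g z * ode_rhs E z y) / deriv f z =
        ode_rhs E' (f z) (g z * y + h z)"
      by (simp add: prolong_def jet_locus_def)
  qed
next
  assume R: ?R
  show ?L
  proof (intro equalityI subsetI)
    fix w assume "w \<in> prolong f g h ` jet_locus E V"
    then show "w \<in> jet_locus E' (f ` V)" using R by (auto simp: prolong_def jet_locus_def)
  next
    fix w assume "w \<in> jet_locus E' (f ` V)"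
    then obtain z Y where z: "z \<in> V" and w: "w = (f z, Y, ode_rhs E' (f z) Y)"
      by (auto simp: jet_locus_def)
    define y where "y = (Y - h z) / g z"
    have "g z * y + h z = Y" using assms z by (simp add: y_def)
    then have "w = prolong f g h (z, y, ode_rhs E z y)"
      using R z unfolding w prolong_def by auto
    then show "w \<in> prolong f g h ` jet_locus E V" using z by (auto simp: jet_locus_def)
  qed
qed

text \<open>Comparison of coefficients for the map \<open>u \<mapsto> c u + d\<close> between reduced equations; \<open>c1\<close>, \<open>d1\<close>, \<open>f1\<close>
are the values of the derivatives of \<open>c\<close>, \<open>d\<close>, \<open>f\<close>. Only the right-hand side can have a term of
degree 4, with coefficient proportional to \<open>d\<close>, and this forces \<open>d = 0\<close>.\<close>

lemma reduced_rhs_match_iff: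
  fixes p A B P A' B' c c1 d d1 f1 :: real
  assumes "c \<noteq> 0" "f1 \<noteq> 0" "P \<noteq> 0"
  shows "(\<forall>u. c1 * u + d1 + c * (p * u ^ 5 + A * u + B) =
      f1 * (P * (c * u + d) ^ 5 + A' * (c * u + d) + B')) \<longleftrightarrow>
    d = 0 \<and> P * f1 * c ^ 4 = p \<and> c1 + c * A = f1 * A' * c \<and> d1 + c * B = f1 * B'"
    (is "?L \<longleftrightarrow> ?R")
proof
  assume L: ?L
  define k where "k = f1 * P"
  \<comment> \<open>\<open>a\<^sub>i\<close> is the coefficient of degree \<open>i\<close> of the difference of the two sides\<close>
  define a5 a4 a3 a2 a1 a0 where "a5 = c * p - k * c ^ 5" and "a4 = - 5 * k * c ^ 4 * d"
    and "a3 = - 10 * k * c ^ 3 * d ^ 2" and "a2 = - 10 * k * c ^ 2 * d ^ 3"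
    and "a1 = c1 + c * A - 5 * k * c * d ^ 4 - f1 * A' * c"
    and "a0 = d1 + c * B - k * d ^ 5 - f1 * A' * d - f1 * B'"
  note coeff_defs = a0_def a1_def a2_def a3_def a4_def a5_def
  have "poly [:a0, a1, a2, a3, a4, a5:] u = 0" for u
  proof -
    have "poly [:a0, a1, a2, a3, a4, a5:] u =
      a0 + u * (a1 + u * (a2 + u * (a3 + u * (a4 + u * a5))))" by simp
    also have "\<dots> = c1 * u + d1 + c * (p * u ^ 5 + A * u + B) -
        f1 * (P * (c * u + d) ^ 5 + A' * (c * u + d) + B')"
      unfolding coeff_defs k_def by algebra
    also have "\<dots> = 0" using L by simp
    finally show ?thesis .
  qed
  then have "[:a0, a1, a2, a3, a4, a5:] = 0"
    using poly_all_0_iff_0 by blast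
  then have zero: "a0 = 0" "a1 = 0" "a4 = 0" "a5 = 0" by (simp_all only: pCons_eq_0_iff)
  have "d = 0" using zero(3) assms by (simp add: a4_def k_def)
  moreover have "c * p = c * (P * f1 * c ^ 4)"
    using zero(4) unfolding a5_def k_def by algebra
  ultimately show ?R using zero(1,2) assms(1) by (simp add: a0_def a1_def)
next
  assume R: ?R
  then have "p = P * f1 * c ^ 4" by simp
  with R show ?L by algebra
qed

locale fibred_change = src: nondegenerate E + tgt: nondegenerate E'
  for E E' :: quintic_ode +
  fixes V :: "real set" and f g h :: "real \<Rightarrow> real"
  assumes V_sub: "V \<subseteq> base E" and fV_sub: "f ` V \<subseteq> base E'"
    and pseudogroup: "pseudogroup_on V f g h"
begin

text \<open>In the reduced variables \<open>u = p y + q\<close> and \<open>U = P Y + Q\<close>, where capitals belong to the second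
equation at \<open>f z\<close>, the transformation is \<open>U = c u + d\<close>.\<close>

definition c :: "real \<Rightarrow> real" where
  "c z = coef_p E' (f z) * g z / coef_p E z"

definition d :: "real \<Rightarrow> real" where
  "d z = coef_p E' (f z) * h z + coef_q E' (f z) - c z * coef_q E z"

lemma open_V: "open V"
  and smooth_f: "smooth_on V f" and smooth_g: "smooth_on V g" and smooth_h: "smooth_on V h"
  and f'_nz: "z \<in> V \<Longrightarrow> deriv f z \<noteq> 0" and g_nz: "z \<in> V \<Longrightarrow> g z \<noteq> 0"
  using pseudogroup by (auto simp: pseudogroup_on_def local_change_on_def)

lemma in_src: "z \<in> V \<Longrightarrow> z \<in> base E" and in_tgt: "z \<in> V \<Longrightarrow> f z \<in> base E'"
  using V_sub fV_sub by auto

lemma has_deriv_compose: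
  assumes "smooth_on (base E') \<phi>" "z \<in> V"
  shows "((\<lambda>z. \<phi> (f z)) has_real_derivative deriv \<phi> (f z) * deriv f z) (at z)"
  by (rule DERIV_chain2[where g = f, OF smooth_on_has_deriv[OF assms(1) in_tgt[OF assms(2)]]
        smooth_on_has_deriv[OF smooth_f assms(2)]])

lemma smooth_c: "smooth_on V c"
  unfolding c_def
  by (intro smooth_intros open_V smooth_g smooth_on_compose[OF _ smooth_f tgt.smooth_p fV_sub]
      smooth_on_subset[OF src.smooth_p V_sub])
    (use in_src src.p_nz in auto)

lemma smooth_d: "smooth_on V d"
  unfolding d_def
  by (intro smooth_intros open_V smooth_c smooth_h
      smooth_on_compose[OF _ smooth_f tgt.smooth_p fV_sub]
      smooth_on_compose[OF _ smooth_f tgt.smooth_q fV_sub]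
      smooth_on_subset[OF src.smooth_q V_sub])

lemma c_nz: "z \<in> V \<Longrightarrow> c z \<noteq> 0"
  using in_src in_tgt src.p_nz tgt.p_nz g_nz by (simp add: c_def)

text \<open>The condition on jets, multiplied by \<open>P\<close> and rewritten in reduced variables, is an identity between
polynomials in \<open>u\<close>; as \<open>p \<noteq> 0\<close>, \<open>u\<close> takes every value, and the coefficients can be compared. The
derivatives of \<open>g\<close> and \<open>h\<close> are eliminated by differentiating \<open>P g = c p\<close> and \<open>P h + Q = c q + d\<close>.\<close>

lemma jet_condition_iff:
  assumes z: "z \<in> V"
  shows "(\<forall>y. (deriv g z * y + deriv h z + g z * ode_rhs E z y) / deriv f z =
       ode_rhs E' (f z) (g z * y + h z)) \<longleftrightarrow>
    d z = 0 \<and> coef_p E' (f z) * deriv f z * c z ^ 4 = coef_p E z \<and>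
    deriv c z + c z * lin_coef E z = deriv f z * lin_coef E' (f z) * c z \<and>
    deriv d z + c z * (M2 E z / coef_p E z) = deriv f z * (M2 E' (f z) / coef_p E' (f z))"
    (is "?jet \<longleftrightarrow> ?match")
proof -
  define p q P Q where "p = coef_p E z" and "q = coef_q E z"
    and "P = coef_p E' (f z)" and "Q = coef_q E' (f z)"
  define p1 q1 P1 Q1 where "p1 = deriv (coef_p E) z" and "q1 = deriv (coef_q E) z"
    and "P1 = deriv (coef_p E') (f z)" and "Q1 = deriv (coef_q E') (f z)"
  note defs = p_def q_def P_def Q_def p1_def q1_def P1_def Q1_def
  have nz: "p \<noteq> 0" "P \<noteq> 0" "c z \<noteq> 0" "deriv f z \<noteq> 0"
    using z in_src in_tgt src.p_nz tgt.p_nz c_nz f'_nz by (auto simp: p_def P_def)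
  note deriv_src = smooth_on_has_deriv[OF _ in_src[OF z]]
  note deriv_V = smooth_on_has_deriv[OF _ z]
  note deriv_tgt = has_deriv_compose[OF _ z]
  have g1: "P1 * deriv f z * g z + P * deriv g z = deriv c z * p + c z * p1"
  proof (rule DERIV_unique)
    show "((\<lambda>z. coef_p E' (f z) * g z) has_real_derivative
        P1 * deriv f z * g z + P * deriv g z) (at z)"
      by (auto intro!: derivative_eq_intros deriv_tgt deriv_V tgt.smooth_p smooth_g simp: defs)
    have "((\<lambda>z. c z * coef_p E z) has_real_derivative deriv c z * p + c z * p1) (at z)"
      by (auto intro!: derivative_eq_intros deriv_V deriv_src src.smooth_p smooth_c simp: defs)
    then show "((\<lambda>z. coef_p E' (f z) * g z) has_real_derivative deriv c z * p + c z * p1) (at z)"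
      by (rule has_field_derivative_transform_within_open[OF _ open_V z])
        (use in_src src.p_nz in \<open>simp add: c_def\<close>)
  qed
  have h1: "P1 * deriv f z * h z + P * deriv h z + Q1 * deriv f z =
      deriv c z * q + c z * q1 + deriv d z"
  proof (rule DERIV_unique)
    show "((\<lambda>z. coef_p E' (f z) * h z + coef_q E' (f z)) has_real_derivative
        P1 * deriv f z * h z + P * deriv h z + Q1 * deriv f z) (at z)"
      by (auto intro!: derivative_eq_intros deriv_tgt deriv_V tgt.smooth_p tgt.smooth_q smooth_h
          simp: defs)
    have "((\<lambda>z. c z * coef_q E z + d z) has_real_derivative
        deriv c z * q + c z * q1 + deriv d z) (at z)"
      by (auto intro!: derivative_eq_intros deriv_V deriv_src src.smooth_q smooth_c smooth_d
          simp: defs)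
    then show "((\<lambda>z. coef_p E' (f z) * h z + coef_q E' (f z)) has_real_derivative
        deriv c z * q + c z * q1 + deriv d z) (at z)"
      by (rule has_field_derivative_transform_within_open[OF _ open_V z]) (simp add: d_def)
  qed
  have gc: "P * g z = c z * p" and hd: "P * h z + Q = c z * q + d z"
    using nz by (auto simp: c_def d_def defs)
  \<comment> \<open>the two expressions for \<open>dU/dx\<close>: along the first equation, and from the second one\<close>
  define L R where
    "L u = deriv c z * u + deriv d z + c z * (p * u ^ 5 + lin_coef E z * u + M2 E z / p)" and
    "R u = deriv f z * (P * (c z * u + d z) ^ 5 + lin_coef E' (f z) * (c z * u + d z) +
      M2 E' (f z) / P)" for u
  have jet: "(deriv g z * y + deriv h z + g z * ode_rhs E z y) / deriv f z =
      ode_rhs E' (f z) (g z * y + h z) \<longleftrightarrow> L (p * y + q) = R (p * y + q)" for y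
  proof -
    define Y where "Y = g z * y + h z"
    have Y: "P * Y + Q = c z * (p * y + q) + d z"
      unfolding Y_def using gc hd by algebra
    have "L (p * y + q) = deriv c z * (p * y + q) + deriv d z +
        c z * (p1 * y + q1 + p * ode_rhs E z y)"
      using src.reduced_rhs[OF in_src[OF z], of y] by (simp add: L_def defs)
    also have "\<dots> = (deriv c z * p + c z * p1) * y + (deriv c z * q + c z * q1 + deriv d z) +
        (c z * p) * ode_rhs E z y"
      by (simp add: algebra_simps)
    also have "\<dots> = P * (deriv g z * y + deriv h z + g z * ode_rhs E z y) +
        deriv f z * (P1 * Y + Q1)"
      unfolding g1[symmetric] h1[symmetric] gc[symmetric] by (simp add: Y_def algebra_simps)
    finally have L: "L (p * y + q) = \<dots>" .
    have R: "R (p * y + q) = deriv f z * (P1 * Y + Q1 + P * ode_rhs E' (f z) Y)"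
      using tgt.reduced_rhs[OF in_tgt[OF z], of Y] Y by (simp add: R_def defs)
    have "X / deriv f z = r \<longleftrightarrow> P * X + deriv f z * K = deriv f z * (K + P * r)" for X r K
      using nz by (auto simp: field_simps)
    then show ?thesis
      unfolding L R Y_def[symmetric] .
  qed
  have "?jet \<longleftrightarrow> (\<forall>u. L u = R u)"
  proof
    assume ?jet
    show "\<forall>u. L u = R u"
    proof
      fix u
      have "p * ((u - q) / p) + q = u" using nz by simp
      then show "L u = R u" using jet[of "(u - q) / p"] \<open>?jet\<close> by metis
    qed
  qed (use jet in blast)
  also have "\<dots> \<longleftrightarrow> ?match"
    unfolding L_def R_def reduced_rhs_match_iff[OF nz(3,4,2)]
    by (simp only: defs)
  finally show ?thesis .
qed

lemma deriv_d_zero: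
  assumes "\<And>w. w \<in> V \<Longrightarrow> d w = 0" and z: "z \<in> V"
  shows "deriv d z = 0"
proof (rule DERIV_imp_deriv)
  show "(d has_real_derivative 0) (at z)"
    by (rule has_field_derivative_transform_within_open[OF DERIV_const[of 0] open_V z])
      (simp add: assms(1))
qed

text \<open>Under \<open>d = 0\<close> and \<open>\<lambda>\<^sub>E' \<circ> f = c \<lambda>\<^sub>E\<close> the map is the identity in the variable \<open>v = u/\<lambda>\<close>. Then the
coefficient of degree 5 says that the one-forms match, the constant coefficient says the same, and
the linear one says that the values of \<open>J\<close> agree.\<close>

lemma normal_form_match_iff:
  assumes z: "z \<in> V" and d: "\<And>w. w \<in> V \<Longrightarrow> d w = 0"
    and scale: "\<And>w. w \<in> V \<Longrightarrow> scale_factor E' (f w) = c w * scale_factor E w"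
  shows "(\<forall>y. (deriv g z * y + deriv h z + g z * ode_rhs E z y) / deriv f z =
       ode_rhs E' (f z) (g z * y + h z)) \<longleftrightarrow>
    speed E' (f z) * deriv f z = speed E z \<and> J E' (f z) = J E z"
proof -
  note nz = src.scale_nz[OF in_src[OF z]] c_nz[OF z] src.speed_nz[OF in_src[OF z]]
  have d1: "deriv d z = 0" using d z by (rule deriv_d_zero)
  have scale1: "deriv (scale_factor E') (f z) * deriv f z =
      deriv c z * scale_factor E z + c z * deriv (scale_factor E) z"
  proof (rule DERIV_unique)
    show "((\<lambda>z. scale_factor E' (f z)) has_real_derivative deriv (scale_factor E') (f z) * deriv f z) (at z)"
      by (rule has_deriv_compose[OF tgt.smooth_scale z])
    have "((\<lambda>z. c z * scale_factor E z) has_real_derivative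
        deriv c z * scale_factor E z + c z * deriv (scale_factor E) z) (at z)"
      by (auto intro!: derivative_eq_intros smooth_on_has_deriv[OF smooth_c z]
          smooth_on_has_deriv[OF src.smooth_scale in_src[OF z]])
    then show "((\<lambda>z. scale_factor E' (f z)) has_real_derivative
        deriv c z * scale_factor E z + c z * deriv (scale_factor E) z) (at z)"
      by (rule has_field_derivative_transform_within_open[OF _ open_V z]) (simp add: scale)
  qed
  have quintic: "coef_p E' (f z) * deriv f z * c z ^ 4 = coef_p E z \<longleftrightarrow>
      speed E' (f z) * deriv f z = speed E z"
  proof -
    have "speed E' (f z) * deriv f z =
        (coef_p E' (f z) * deriv f z * c z ^ 4) * scale_factor E z ^ 4"
      by (simp add: speed_def scale[OF z] power_mult_distrib)
    then show ?thesis using nz(1) by (simp only: speed_def) simp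
  qed
  have const: "c z * (M2 E z / coef_p E z) = deriv f z * (M2 E' (f z) / coef_p E' (f z))"
    if "coef_p E' (f z) * deriv f z * c z ^ 4 = coef_p E z"
  proof -
    have "c z * (scale_factor E z ^ 5 * coef_p E z) =
        deriv f z * ((c z * scale_factor E z) ^ 5 * coef_p E' (f z))"
      unfolding that[symmetric] by (simp add: power_mult_distrib eval_nat_numeral mult_ac)
    then show ?thesis
      by (simp only: src.constant_term_eq[OF in_src[OF z]] tgt.constant_term_eq[OF in_tgt[OF z]]
          scale[OF z])
  qed
  have linear: "deriv c z + c z * lin_coef E z = deriv f z * lin_coef E' (f z) * c z \<longleftrightarrow>
      J E' (f z) = J E z"
    if speed: "speed E' (f z) * deriv f z = speed E z"
  proof -
    have J': "J E' (f z) * speed E z = 5 * (deriv c z / c z +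
        deriv (scale_factor E) z / scale_factor E z - deriv f z * lin_coef E' (f z))"
    proof -
      have "J E' (f z) * speed E z = deriv f z * (J E' (f z) * speed E' (f z))"
        unfolding speed[symmetric] by simp
      also have "\<dots> = 5 * (deriv (scale_factor E') (f z) * deriv f z / scale_factor E' (f z) -
          deriv f z * lin_coef E' (f z))"
        unfolding tgt.J_eq[OF in_tgt[OF z]] by (simp add: right_diff_distrib)
      also have "deriv (scale_factor E') (f z) * deriv f z / scale_factor E' (f z) =
          deriv c z / c z + deriv (scale_factor E) z / scale_factor E z"
        unfolding scale1 scale[OF z] using nz(1,2) by (simp add: add_divide_distrib)
      finally show ?thesis .
    qed
    have "J E' (f z) = J E z \<longleftrightarrow> J E' (f z) * speed E z = J E z * speed E z"
      using nz(3) by simp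
    also have "\<dots> \<longleftrightarrow> deriv c z / c z + lin_coef E z = deriv f z * lin_coef E' (f z)"
      unfolding J' src.J_eq[OF in_src[OF z]] by auto
    also have "\<dots> \<longleftrightarrow> deriv c z + c z * lin_coef E z = deriv f z * lin_coef E' (f z) * c z"
    proof -
      have "deriv c z / c z + lin_coef E z = (deriv c z + c z * lin_coef E z) / c z"
        using nz(2) by (simp add: add_divide_distrib)
      then show ?thesis using nz(2) by (simp add: divide_eq_eq)
    qed
    finally show ?thesis by blast
  qed
  show ?thesis
    unfolding jet_condition_iff[OF z] d1 add_0_left using d[OF z] quintic const linear by blast
qed

text \<open>Here \<open>\<lambda>\<^sub>E' \<circ> f = c \<lambda>\<^sub>E\<close> is a consequence: dividing the relation between the constant coefficients by
that between the leading ones gives equality of the fifth powers.\<close>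

lemma equivalence_preserves_normal_form:
  assumes "prolong f g h ` jet_locus E V = jet_locus E' (f ` V)" and z: "z \<in> V"
  shows "speed E' (f z) * deriv f z = speed E z \<and> J E' (f z) = J E z"
proof -
  have jets: "\<forall>y. (deriv g w * y + deriv h w + g w * ode_rhs E w y) / deriv f w =
       ode_rhs E' (f w) (g w * y + h w)" if "w \<in> V" for w
  proof -
    have "\<forall>z\<in>V. g z \<noteq> 0" using g_nz by blast
    from prolong_image_iff[OF this, THEN iffD1, OF assms(1)] that show ?thesis by (rule bspec)
  qed
  have d: "d w = 0" if "w \<in> V" for w
    using jet_condition_iff[OF that, THEN iffD1, OF jets[OF that]] by (rule conjunct1)
  have scale: "scale_factor E' (f w) = c w * scale_factor E w" if w: "w \<in> V" for w
  proof -
    have "deriv d w = 0" by (rule deriv_d_zero[OF d w])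
    then have P: "coef_p E' (f w) * deriv f w * c w ^ 4 = coef_p E w"
      and B: "c w * (M2 E w / coef_p E w) = deriv f w * (M2 E' (f w) / coef_p E' (f w))"
      using jet_condition_iff[OF w, THEN iffD1, OF jets[OF w]] by simp_all
    have "(coef_p E' (f w) * deriv f w) * scale_factor E' (f w) ^ 5 =
        (coef_p E' (f w) * deriv f w) * (c w * scale_factor E w) ^ 5"
    proof -
      have "(coef_p E' (f w) * deriv f w) * scale_factor E' (f w) ^ 5 =
          c w * (scale_factor E w ^ 5 * coef_p E w)"
        using B src.constant_term_eq[OF in_src[OF w]] tgt.constant_term_eq[OF in_tgt[OF w]]
        by (simp add: mult_ac)
      also have "\<dots> = (coef_p E' (f w) * deriv f w) * (c w * scale_factor E w) ^ 5"
        unfolding P[symmetric] by (simp add: power_mult_distrib eval_nat_numeral mult_ac)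
      finally show ?thesis .
    qed
    then have "scale_factor E' (f w) ^ 5 = (c w * scale_factor E w) ^ 5"
      using tgt.p_nz[OF in_tgt[OF w]] f'_nz[OF w] by simp
    then show ?thesis by (metis odd_numeral odd_real_root_power_cancel)
  qed
  show ?thesis
    by (rule normal_form_match_iff[THEN iffD1, OF z d scale jets[OF z]])
qed

end

section \<open>The criterion\<close>

lemma G_equivalent_imp_invariants:
  assumes "nondegenerate E" "nondegenerate E'" and "G_equivalent_near E E' x"
  shows "\<exists>V f. x \<in> V \<and> V \<subseteq> base E \<and> local_change_on V f \<and> f ` V \<subseteq> base E' \<and>
    (\<forall>z\<in>V. J E z = J E' (f z) \<and> nabla J E z = nabla J E' (f z))"
proof -
  obtain V f g h where V: "x \<in> V" "V \<subseteq> base E" and G: "pseudogroup_on V f g h"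
    and fV: "f ` V \<subseteq> base E'" and jets: "prolong f g h ` jet_locus E V = jet_locus E' (f ` V)"
    using assms(3) unfolding G_equivalent_near_def by blast
  interpret fibred_change E E' V f g h
    using assms V G fV by (simp add: fibred_change_def fibred_change_axioms_def)
  note match = equivalence_preserves_normal_form[OF jets]
  have nabla: "nabla J E z = nabla J E' (f z)" if z: "z \<in> V" for z
  proof -
    have "(J E has_real_derivative deriv (J E') (f z) * deriv f z) (at z)"
      by (rule has_field_derivative_transform_within_open[OF
            has_deriv_compose[OF tgt.smooth_J z] open_V z]) (use match in auto)
    then have "deriv (J E) z = deriv (J E') (f z) * deriv f z" by (rule DERIV_imp_deriv)
    moreover have "speed E z = speed E' (f z) * deriv f z" using match[OF z] by simp
    ultimately show ?thesis
      using f'_nz[OF z] by (simp add: src.nabla_eq[OF in_src[OF z]] tgt.nabla_eq[OF in_tgt[OF z]])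
  qed
  have invariants: "\<forall>z\<in>V. J E z = J E' (f z) \<and> nabla J E z = nabla J E' (f z)"
    using match nabla by (intro ballI conjI) (rule sym, blast+)
  have "local_change_on V f" using G by (simp add: pseudogroup_on_def)
  then show ?thesis
    by (intro exI[of _ V] exI[of _ f] conjI V fV invariants)
qed

text \<open>The functions \<open>g\<close> and \<open>h\<close> are obtained by solving \<open>v(x, y) = v(f x, g y + h)\<close>, where \<open>v\<close> on each
side is the normalised variable of the equation concerned.\<close>

lemma normal_form_match_imp_equivalent:
  assumes "nondegenerate E" "nondegenerate E'" and V: "x \<in> V" "V \<subseteq> base E"
    and f: "local_change_on V f" "f ` V \<subseteq> base E'"
    and speed: "\<And>z. z \<in> V \<Longrightarrow> speed E' (f z) * deriv f z = speed E z"
    and J: "\<And>z. z \<in> V \<Longrightarrow> J E' (f z) = J E z"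
  shows "G_equivalent_near E E' x"
proof -
  interpret src: nondegenerate E by fact
  interpret tgt: nondegenerate E' by fact
  define k where "k z = scale_factor E' (f z) / scale_factor E z" for z
  define g where "g z = k z * coef_p E z / coef_p E' (f z)" for z
  define h where "h z = (k z * coef_q E z - coef_q E' (f z)) / coef_p E' (f z)" for z
  have openV: "open V" and smooth_f: "smooth_on V f" using f(1) by (auto simp: local_change_on_def)
  have nz: "scale_factor E z \<noteq> 0" "scale_factor E' (f z) \<noteq> 0" "coef_p E z \<noteq> 0" "coef_p E' (f z) \<noteq> 0"
    if "z \<in> V" for z
    using that V(2) f(2) src.scale_nz tgt.scale_nz src.p_nz tgt.p_nz by blast+
  note smooth_coeffs =
    smooth_on_subset[OF src.smooth_p V(2)] smooth_on_subset[OF src.smooth_q V(2)]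
    smooth_on_subset[OF src.smooth_scale V(2)]
    smooth_on_compose[OF openV smooth_f tgt.smooth_p f(2)]
    smooth_on_compose[OF openV smooth_f tgt.smooth_q f(2)]
    smooth_on_compose[OF openV smooth_f tgt.smooth_scale f(2)]
  have smooth_k: "smooth_on V k" unfolding k_def
    by (intro smooth_intros openV smooth_coeffs) (use nz in auto)
  have "smooth_on V g" unfolding g_def
    by (intro smooth_intros openV smooth_k smooth_coeffs) (use nz in auto)
  moreover have "smooth_on V h" unfolding h_def
    by (intro smooth_intros openV smooth_k smooth_coeffs) (use nz in auto)
  moreover have g_nonzero: "\<forall>z\<in>V. g z \<noteq> 0" using nz by (simp add: g_def k_def)
  ultimately have G: "pseudogroup_on V f g h" using f(1) by (simp add: pseudogroup_on_def)
  interpret fibred_change E E' V f g h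
    using assms G by (simp add: fibred_change_def fibred_change_axioms_def)
  have c: "c w = k w" if "w \<in> V" for w using nz[OF that] by (simp add: c_def g_def)
  have d: "d w = 0" if "w \<in> V" for w
    using nz[OF that] c[OF that] by (simp add: d_def h_def)
  have scale: "scale_factor E' (f w) = c w * scale_factor E w" if "w \<in> V" for w
    using nz[OF that] c[OF that] by (simp add: k_def)
  have "prolong f g h ` jet_locus E V = jet_locus E' (f ` V)"
    unfolding prolong_image_iff[OF g_nonzero]
  proof
    fix z assume z: "z \<in> V"
    show "\<forall>y. (deriv g z * y + deriv h z + g z * ode_rhs E z y) / deriv f z =
        ode_rhs E' (f z) (g z * y + h z)"
      by (rule normal_form_match_iff[THEN iffD2, OF z d scale conjI[OF speed[OF z] J[OF z]]])
  qed
  then show ?thesis using V f(2) G unfolding G_equivalent_near_def by blast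
qed

lemma eventually_nonzero_if_deriv_nonzero:
  fixes F :: "real \<Rightarrow> real"
  assumes "(F has_real_derivative D) (at x)" "F x \<noteq> 0 \<or> D \<noteq> 0"
  shows "\<forall>\<^sub>F z in at x. F z \<noteq> 0"
proof (cases "F x = 0")
  case True
  have "((\<lambda>z. (F z - F x) / (z - x)) \<longlongrightarrow> D) (at x)"
    using assms(1) by (simp add: has_field_derivative_iff)
  then have "\<forall>\<^sub>F z in at x. (F z - F x) / (z - x) \<noteq> 0"
    using True assms(2) by (intro tendsto_imp_eventually_ne) auto
  then show ?thesis by (rule eventually_mono) (use True in auto)
next
  case False
  have "(F \<longlongrightarrow> F x) (at x)"
    using DERIV_isCont[OF assms(1)] by (simp add: isCont_def)
  then show ?thesis using False by (rule tendsto_imp_eventually_ne)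
qed

text \<open>At a zero of \<open>\<nabla> J\<close> the equality of invariants says nothing about the one-forms. If \<open>\<nabla> J\<close>
vanishes at \<open>x\<close>, then so does the derivative of \<open>J\<close>, and by regularity the derivative of \<open>\<nabla> J\<close> does
not; so the zero is isolated, and the match extends to \<open>x\<close> by continuity.\<close>

lemma invariants_imp_G_equivalent:
  assumes "nondegenerate E" "nondegenerate E'" and V: "x \<in> V" "V \<subseteq> base E"
    and f: "local_change_on V f" "f ` V \<subseteq> base E'"
    and inv: "\<forall>z\<in>V. J E z = J E' (f z) \<and> nabla J E z = nabla J E' (f z)"
    and regular: "deriv (J E) x \<noteq> 0 \<or> deriv (nabla J E) x \<noteq> 0"
  shows "G_equivalent_near E E' x"
proof -
  interpret src: nondegenerate E by fact
  interpret tgt: nondegenerate E' by fact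
  have openV: "open V" and smooth_f: "smooth_on V f" and f'_nz: "\<And>z. z \<in> V \<Longrightarrow> deriv f z \<noteq> 0"
    using f(1) by (auto simp: local_change_on_def)
  have base: "z \<in> base E" "f z \<in> base E'" if "z \<in> V" for z using that V f by auto
  \<comment> \<open>the density of the pullback of the second one-form under \<open>f\<close>\<close>
  define \<sigma> where "\<sigma> z = speed E' (f z) * deriv f z" for z
  have match: "\<sigma> z = speed E z" if z: "z \<in> V" "nabla J E z \<noteq> 0" for z
  proof -
    have "((\<lambda>z. J E' (f z)) has_real_derivative deriv (J E') (f z) * deriv f z) (at z)"
      by (rule DERIV_chain2[where g = f, OF smooth_on_has_deriv[OF tgt.smooth_J base(2)[OF z(1)]]
            smooth_on_has_deriv[OF smooth_f z(1)]])
    then have "(J E has_real_derivative deriv (J E') (f z) * deriv f z) (at z)"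
      by (rule has_field_derivative_transform_within_open[OF _ openV z(1)]) (use inv in auto)
    then have "deriv (J E) z = deriv (J E') (f z) * deriv f z" by (rule DERIV_imp_deriv)
    moreover have "nabla J E z * speed E z = deriv (J E) z"
      using src.nabla_eq[of z J] src.speed_nz[of z] base(1)[OF z(1)] by simp
    moreover have "nabla J E z * speed E' (f z) = deriv (J E') (f z)"
      using inv z(1) tgt.nabla_eq[of "f z" J] tgt.speed_nz[of "f z"] base(2)[OF z(1)] by simp
    ultimately have "nabla J E z * \<sigma> z = nabla J E z * speed E z"
      by (simp add: \<sigma>_def algebra_simps)
    then show ?thesis using z(2) by simp
  qed
  have "nabla J E x \<noteq> 0 \<or> deriv (nabla J E) x \<noteq> 0"
    using regular V base src.nabla_eq[of x J] src.speed_nz[of x] by auto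
  then have "\<forall>\<^sub>F z in at x. nabla J E z \<noteq> 0"
    using V by (intro eventually_nonzero_if_deriv_nonzero[OF
          smooth_on_has_deriv[OF src.smooth_nabla_J]]) auto
  moreover have "\<forall>\<^sub>F z in at x. z \<in> V"
    using eventually_at_topological openV V(1) by blast
  ultimately have ev: "\<forall>\<^sub>F z in at x. \<sigma> z = speed E z"
    by eventually_elim (rule match)
  have smooth_\<sigma>: "smooth_on V \<sigma>" unfolding \<sigma>_def
    by (intro smooth_intros openV smooth_f smooth_on_compose[OF openV smooth_f tgt.smooth_speed f(2)])
  have "(\<sigma> \<longlongrightarrow> \<sigma> x) (at x)"
    using DERIV_isCont[OF smooth_on_has_deriv[OF smooth_\<sigma> V(1)]] by (simp add: isCont_def)
  moreover have "(\<sigma> \<longlongrightarrow> speed E x) (at x)"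
    using DERIV_isCont[OF smooth_on_has_deriv[OF src.smooth_speed, of x]] V tendsto_cong[OF ev]
    by (auto simp: isCont_def)
  ultimately have "\<sigma> x = speed E x" using tendsto_unique[of "at x"] by simp
  with ev have "\<forall>\<^sub>F z in nhds x. \<sigma> z = speed E z" by (simp add: eventually_nhds_conv_at)
  then obtain S where S: "open S" "x \<in> S" "\<And>z. z \<in> S \<Longrightarrow> \<sigma> z = speed E z"
    unfolding eventually_nhds by blast
  have "local_change_on (V \<inter> S) f"
    using f(1) S(1) smooth_on_subset[of V f "V \<inter> S"] inj_on_subset[of f V "V \<inter> S"]
    by (auto simp: local_change_on_def)
  then show ?thesis
    using V f(2) S inv
    by (intro normal_form_match_imp_equivalent[of E E' x "V \<inter> S" f] assms(1,2))
      (auto simp: \<sigma>_def)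
qed

theorem theorem11:
  fixes E E' :: quintic_ode and x :: real
  assumes "admissible E" and "admissible E'"
    and "\<forall>z\<in>base E. M2 E z \<noteq> 0" and "\<forall>z\<in>base E'. M2 E' z \<noteq> 0"
    and "x \<in> base E"
    and "deriv (J E) x \<noteq> 0 \<or> deriv (nabla J E) x \<noteq> 0"
  shows "G_equivalent_near E E' x \<longleftrightarrow>
    (\<exists>V f. x \<in> V \<and> V \<subseteq> base E \<and> local_change_on V f \<and> f ` V \<subseteq> base E' \<and>
       (\<forall>z\<in>V. J E z = J E' (f z) \<and> nabla J E z = nabla J E' (f z)))"
proof -
  have "nondegenerate E" "nondegenerate E'" using assms by (auto simp: nondegenerate_def)
  then show ?thesis
    using G_equivalent_imp_invariants[of E E' x]
      invariants_imp_G_equivalent[of E E' x, OF _ _ _ _ _ _ _ assms(6)]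
    by metis
qed

end
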